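(* Let $m\ge 2$ be an integer, let $\lambda\neq 0$ be a real constant, let $I\subset(0,\infty)$ be an open interval and let $u:I\to\mathbb R$ be a smooth function with $u'(\alpha)\ne 0$ for all $\alpha\in I$. The rotational surface in $(\mathbb R^3,\|\cdot\|)$ given by $$\bar X(\alpha,v)=(\alpha\cos v,\ \alpha\sin v,\ u(\alpha)),\qquad \alpha\in I,$$ satisfies $k_1+\lambda k_2=0$ (at every point) if and only if $$u(\alpha)=\pm\int\frac{c_2^{(2m-1)\lambda}}{\left(\alpha^{2m\lambda}-c_2^{2m\lambda}\right)^{\frac{2m-1}{2m}}}\,d\alpha$$ for some positive constant $c_2$; that is, if and only if there are $c_2>0$ with $\alpha^{2m\lambda}>c_2^{2m\lambda}$ for all $\alpha\in I$ and a sign (constant on $I$) such that $u$ is an antiderivative on $I$ of $\pm c_2^{(2m-1)\lambda}\left(\alpha^{2m\lambda}-c_2^{2m\lambda}\right)^{-\frac{2m-1}{2m}}$.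
   Context: The norm on $\mathbb R^3$ is $\|x\|=\left((x_1^2+x_2^2)^m+x_3^{2m}\right)^{1/(2m)}$, with $m\ge2$ an integer. Put $\Phi(x)=(x_1^2+x_2^2)^m+x_3^{2m}$; the unit sphere is $S=\{\Phi=1\}$. For an immersed surface $M$ in $(\mathbb R^3,\|\cdot\|)$, a Birkhoff-Gauss map is a local map $\eta:M\to S$ such that, for each $p$, the tangent plane of $S$ at $\eta(p)$ is parallel to $T_pM$ (it is determined up to sign); the principal curvatures are the eigenvalues of $d\eta_p$. For a rotational surface about the $x_3$-axis, parametrized by $X(u,v)=(\alpha(u)\cos v,\alpha(u)\sin v,\beta(u))$ with $\alpha>0$, the sign of $\eta$ is fixed by $(\operatorname{grad}\Phi)_{\eta}=\varphi\,X_u\times X_v$ with $\varphi>0$ ($\times$ the standard cross product), and $k_1,k_2$ are the principal curvatures in the profile and rotation directions: $\eta_u=k_1X_u$, $\eta_v=k_2X_v$. The surface $\bar X$ with $u'\ne0$ is regarded as reparametrized by height, $X(u,v)=(\alpha(u)\cos v,\alpha(u)\sin v,u)$, where $\alpha(u)$ is the inverse function of $u(\alpha)$, so that $\alpha'\neq 0$, and $k_1,k_2$ are taken for this $X$. (The condition $k_1+\lambda k_2=0$ does not depend on the sign of $\eta$.) *)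

theory Defs
  imports "HOL-Analysis.Analysis"
begin

definition smooth_on :: "(real \<Rightarrow> real) \<Rightarrow> real set \<Rightarrow> bool" where
  "smooth_on f S \<longleftrightarrow> (\<forall>n. \<forall>x\<in>S. (deriv ^^ n) f differentiable (at x))"

definition Phi :: "nat \<Rightarrow> real^3 \<Rightarrow> real" where
  "Phi m x = ((x$1)\<^sup>2 + (x$2)\<^sup>2) ^ m + (x$3) ^ (2 * m)"

definition mnorm :: "nat \<Rightarrow> real^3 \<Rightarrow> real" where
  "mnorm m x = root (2 * m) (Phi m x)"

definition unit_sphere :: "nat \<Rightarrow> (real^3) set" where
  "unit_sphere m = {x. mnorm m x = 1}"

lemma unit_sphere_eq: "m > 0 \<Longrightarrow> unit_sphere m = {x. Phi m x = 1}"
  by (simp add: unit_sphere_def mnorm_def)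

(* Linear tangent plane at q of the regular level set of Phi through q (every q \<noteq> 0 is
   a regular point of Phi). *)
definition sphere_tangent_plane :: "nat \<Rightarrow> real^3 \<Rightarrow> (real^3) set" where
  "sphere_tangent_plane m q = {w. frechet_derivative (Phi m) (at q) w = 0}"

(* A surface is an immersion X of an open set U of the (u,v)-plane; maps on the surface
   are written as functions of the parameters, so the tangent plane at X p is the range
   of the derivative of X at p. *)
definition birkhoff_gauss_map ::
    "nat \<Rightarrow> (real \<times> real \<Rightarrow> real^3) \<Rightarrow> (real \<times> real) set \<Rightarrow> (real \<times> real \<Rightarrow> real^3) \<Rightarrow> bool" where
  "birkhoff_gauss_map m X U \<eta> \<longleftrightarrow>
    (\<forall>p\<in>U. \<eta> p \<in> unit_sphere m \<and> \<eta> differentiable (at p) \<and>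
      sphere_tangent_plane m (\<eta> p) = range (frechet_derivative X (at p)))"

abbreviation partial_u :: "(real \<times> real \<Rightarrow> real^3) \<Rightarrow> real \<times> real \<Rightarrow> real^3" where
  "partial_u F p \<equiv> frechet_derivative F (at p) (1, 0)"

abbreviation partial_v :: "(real \<times> real \<Rightarrow> real^3) \<Rightarrow> real \<times> real \<Rightarrow> real^3" where
  "partial_v F p \<equiv> frechet_derivative F (at p) (0, 1)"

definition positively_oriented ::
    "nat \<Rightarrow> (real \<times> real \<Rightarrow> real^3) \<Rightarrow> (real \<times> real) set \<Rightarrow> (real \<times> real \<Rightarrow> real^3) \<Rightarrow> bool" where
  "positively_oriented m X U \<eta> \<longleftrightarrow>
    (\<forall>p\<in>U. \<exists>\<phi>>0. GDERIV (Phi m) (\<eta> p) :> \<phi> *\<^sub>R cross3 (partial_u X p) (partial_v X p))"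

(* The endomorphism d eta_p of the tangent plane sends X_u to eta_u and X_v to eta_v;
   k1 and k2 are its eigenvalues for the eigenvectors X_u and X_v. *)
definition rot_principal_curvatures ::
    "(real \<times> real \<Rightarrow> real^3) \<Rightarrow> (real \<times> real) set \<Rightarrow> (real \<times> real \<Rightarrow> real^3) \<Rightarrow>
      (real \<times> real \<Rightarrow> real) \<Rightarrow> (real \<times> real \<Rightarrow> real) \<Rightarrow> bool" where
  "rot_principal_curvatures X U \<eta> k1 k2 \<longleftrightarrow>
    (\<forall>p\<in>U. partial_u \<eta> p = k1 p *\<^sub>R partial_u X p \<and>
            partial_v \<eta> p = k2 p *\<^sub>R partial_v X p)"

definition rot_surface :: "(real \<Rightarrow> real) \<Rightarrow> (real \<Rightarrow> real) \<Rightarrow> real \<times> real \<Rightarrow> real^3" where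
  "rot_surface \<alpha> \<beta> = (\<lambda>(s, v). vector [\<alpha> s * cos v, \<alpha> s * sin v, \<beta> s])"

definition height_param :: "real set \<Rightarrow> (real \<Rightarrow> real) \<Rightarrow> real \<times> real \<Rightarrow> real^3" where
  "height_param I u = rot_surface (the_inv_into I u) (\<lambda>t. t)"

definition height_domain :: "real set \<Rightarrow> (real \<Rightarrow> real) \<Rightarrow> (real \<times> real) set" where
  "height_domain I u = {(t, v). t \<in> u ` I}"

lemma height_param_reparametrizes:
  assumes "inj_on u I" "a \<in> I"
  shows "height_param I u (u a, v) = rot_surface (\<lambda>a. a) u (a, v)"
  using assms by (simp add: height_param_def rot_surface_def the_inv_into_f_f)

(* The sign condition determines eta, hence k1 and k2, uniquely on the domain. *)
definition satisfies_curvature_relation :: "nat \<Rightarrow> real \<Rightarrow> real set \<Rightarrow> (real \<Rightarrow> real) \<Rightarrow> bool" where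
  "satisfies_curvature_relation m c I u \<longleftrightarrow>
    (\<exists>\<eta> k1 k2.
      birkhoff_gauss_map m (height_param I u) (height_domain I u) \<eta> \<and>
      positively_oriented m (height_param I u) (height_domain I u) \<eta> \<and>
      rot_principal_curvatures (height_param I u) (height_domain I u) \<eta> k1 k2 \<and>
      (\<forall>p\<in>height_domain I u. k1 p + c * k2 p = 0))"

end

theory Submission
  imports Defs
begin

text \<open>
  At height \<open>u a\<close> the profile curve has slope \<open>d = 1 / u' a\<close> over the axis, and the orientation
  forces the Birkhoff-Gauss map to be the rotational surface with profile \<open>(- R, Z)\<close>, where
  \<open>R > 0\<close>, \<open>R ^ (2 * m) + Z ^ (2 * m) = 1\<close> and \<open>Z ^ (2 * m - 1) = R ^ (2 * m - 1) * d\<close>.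
  As functions of \<open>a\<close> this gives \<open>k1 = - R'\<close> and \<open>k2 = - R / a\<close>, so \<open>k1 + \<lambda> * k2 = 0\<close> is the linear
  equation \<open>a * R' + \<lambda> * R = 0\<close>, that is, \<open>R = (c2 / a) powr \<lambda>\<close> for some \<open>c2 > 0\<close>. Solving
  \<open>1 / R ^ (2 * m) = 1 + \<bar>u'\<bar> powr (- 2 * m / (2 * m - 1))\<close> for \<open>\<bar>u'\<bar>\<close> gives the stated integrand;
  the sign of \<open>u'\<close> is constant because \<open>u'\<close> is continuous without zeros.
\<close>

section \<open>The profile of the unit sphere in terms of the slope\<close>

text \<open>
  The point \<open>(R, Z)\<close> for slope \<open>d\<close>. The odd \<^const>\<open>root\<close> is the real one for negative \<open>d\<close>, too.
\<close>

definition profile_radius :: "nat \<Rightarrow> real \<Rightarrow> real" where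
  "profile_radius m d = 1 / root (2 * m) (1 + root (2 * m - 1) d ^ (2 * m))"

definition profile_height :: "nat \<Rightarrow> real \<Rightarrow> real" where
  "profile_height m d = root (2 * m - 1) d * profile_radius m d"

lemma profile_radius_pos:
  assumes "m > 0"
  shows "profile_radius m d > 0"
  using assms by (simp add: profile_radius_def add_pos_nonneg)

lemma profile_slope:
  assumes "m > 0"
  shows "profile_height m d ^ (2 * m - 1) = profile_radius m d ^ (2 * m - 1) * d"
  using assms by (simp add: profile_height_def power_mult_distrib odd_real_root_pow)

lemma profile_radius_power:
  assumes "m > 0"
  shows "profile_radius m d ^ (2 * m) = 1 / (1 + root (2 * m - 1) d ^ (2 * m))"
  using assms by (simp add: profile_radius_def power_divide)

lemma profile_sphere:
  assumes "m > 0"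
  shows "profile_radius m d ^ (2 * m) + profile_height m d ^ (2 * m) = 1"
proof -
  have "1 + root (2 * m - 1) d ^ (2 * m) > 0"
    by (simp add: add_pos_nonneg)
  then show ?thesis
    unfolding profile_height_def power_mult_distrib profile_radius_power[OF assms]
    by (simp add: field_simps)
qed

text \<open>Odd powers are injective on the reals, so the slope equation gives
  \<open>z = r * b\<close> with \<open>b\<close> the odd root of \<open>d\<close>. The sphere
  equation then fixes \<open>r ^ (2 * m)\<close>, and positivity fixes \<open>r\<close>.\<close>

lemma profile_unique:
  fixes r z :: real
  assumes m: "m > 0" and "r > 0"
    and slope: "z ^ (2 * m - 1) = r ^ (2 * m - 1) * d"
    and sphere: "r ^ (2 * m) + z ^ (2 * m) = 1"
  shows "r = profile_radius m d" "z = profile_height m d"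
proof -
  define b where "b = root (2 * m - 1) d"
  have odd: "odd (2 * m - 1)"
    using m by simp
  have "z ^ (2 * m - 1) = (r * b) ^ (2 * m - 1)"
    by (simp only: slope b_def power_mult_distrib odd_real_root_pow[OF odd])
  then have z: "z = r * b"
    using odd odd_real_root_power_cancel by metis
  have "r ^ (2 * m) * (1 + b ^ (2 * m)) = 1"
    using sphere by (simp add: z power_mult_distrib algebra_simps)
  moreover have "profile_radius m d ^ (2 * m) * (1 + b ^ (2 * m)) = 1"
    using profile_sphere[OF m, of d]
    by (simp add: profile_height_def b_def power_mult_distrib algebra_simps)
  moreover have "1 + b ^ (2 * m) \<noteq> 0"
    using add_pos_nonneg[OF zero_less_one zero_le_even_power[of "2 * m" b]] by simp
  ultimately have "r ^ (2 * m) = profile_radius m d ^ (2 * m)"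
    by (metis mult_right_cancel)
  then show "r = profile_radius m d"
    using m \<open>r > 0\<close> profile_radius_pos[OF m, of d] by (simp add: power_eq_iff_eq_base)
  then show "z = profile_height m d"
    by (simp add: z profile_height_def b_def mult.commute)
qed

text \<open>The chain rule passes through the odd root, which is differentiable away from 0; the
  argument of the even root is at least 1.\<close>

lemma profile_radius_differentiable:
  assumes "m > 0" "d \<noteq> 0"
  shows "profile_radius m differentiable (at d)"
proof -
  let ?b = "root (2 * m - 1)"
  have pos: "1 + ?b d ^ (2 * m) > 0"
    by (simp add: add_pos_nonneg)
  have b: "?b differentiable (at d)"
    using DERIV_odd_real_root[of "2 * m - 1" d] assms by (auto simp: real_differentiable_def)
  then have "(\<lambda>d. 1 + ?b d ^ (2 * m)) differentiable (at d)"
    by simp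
  moreover have "root (2 * m) differentiable (at (1 + ?b d ^ (2 * m)))"
    using DERIV_real_root[OF _ pos, of "2 * m"] assms by (auto simp: real_differentiable_def)
  ultimately have "(\<lambda>d. root (2 * m) (1 + ?b d ^ (2 * m))) differentiable (at d)"
    by (rule differentiable_compose[rotated])
  moreover have "root (2 * m) (1 + ?b d ^ (2 * m)) \<noteq> 0"
    using pos assms by simp
  ultimately have "(\<lambda>d. 1 / root (2 * m) (1 + ?b d ^ (2 * m))) differentiable (at d)"
    by (intro differentiable_divide) auto
  then show ?thesis
    unfolding profile_radius_def .
qed

lemma profile_height_differentiable:
  assumes "m > 0" "d \<noteq> 0"
  shows "profile_height m differentiable (at d)"
proof -
  have "root (2 * m - 1) differentiable (at d)"
    using DERIV_odd_real_root[of "2 * m - 1" d] assms by (auto simp: real_differentiable_def)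
  then show ?thesis
    unfolding profile_height_def
    using profile_radius_differentiable[OF assms] by (intro differentiable_mult)
qed

section \<open>Points of the sphere with prescribed normal direction\<close>

lemma GDERIV_Phi:
  assumes "m > 0"
  shows "GDERIV (Phi m) x :>
    vector [2 * m * ((x$1)\<^sup>2 + (x$2)\<^sup>2) ^ (m - 1) * x$1,
            2 * m * ((x$1)\<^sup>2 + (x$2)\<^sup>2) ^ (m - 1) * x$2,
            2 * m * (x$3) ^ (2 * m - 1)]"
proof -
  have nth: "((\<lambda>x. x $ i) has_derivative (\<lambda>x. x $ i)) (at x)" for i and x :: "real^3"
    by (rule bounded_linear.has_derivative[OF bounded_linear_vec_nth has_derivative_ident])
  show ?thesis
    unfolding gderiv_def Phi_def
    apply (rule has_derivative_subst)
     apply (rule derivative_eq_intros nth refl)+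
    apply (auto simp: fun_eq_iff inner_vec_def sum_3 algebra_simps power2_eq_square)
    done
qed

lemma GDERIV_unique:
  assumes "GDERIV f x :> D" "GDERIV f x :> E"
  shows "D = E"
proof -
  have "(\<lambda>h. inner h D) = (\<lambda>h. inner h E)"
    using assms has_derivative_unique unfolding gderiv_def by blast
  then show ?thesis
    by (simp add: fun_eq_iff vector_eq_ldot)
qed

lemma vector_3_eq_iff:
  "vector [a, b, c] = (x :: 'a::zero^3) \<longleftrightarrow> a = x$1 \<and> b = x$2 \<and> c = x$3"
  by (simp add: vec_eq_iff forall_3)

text \<open>The length of the horizontal part of the gradient determines the distance
  \<open>r\<close> from the axis, its direction determines the angle, and the vertical component
  then yields the slope relation required by \<open>profile_unique\<close>.\<close>

lemma sphere_point_unique: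
  assumes m: "m > 0" and "\<phi> > 0" "a > 0"
    and sphere: "Phi m x = 1"
    and grad: "GDERIV (Phi m) x :> \<phi> *\<^sub>R vector [- a * cos v, - a * sin v, a * d]"
  shows "x = vector [- profile_radius m d * cos v, - profile_radius m d * sin v,
    profile_height m d]"
proof -
  define r where "r = sqrt ((x$1)\<^sup>2 + (x$2)\<^sup>2)"
  \<comment> \<open>The factor 2m of the gradient is absorbed into \<open>K\<close>, so that the
    component equations become r^(2m-2) x_1 = - K cos v, and so on.\<close>
  define K where "K = \<phi> * a / (2 * m)"
  obtain n where n: "m = Suc n"
    using m gr0_conv_Suc by blast
  have K: "K > 0"
    using assms by (simp add: K_def)
  have r: "r \<ge> 0" and r2: "(x$1)\<^sup>2 + (x$2)\<^sup>2 = r\<^sup>2"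
    by (simp_all add: r_def)
  have eqs: "r ^ (2 * n) * x$1 = - K * cos v" "r ^ (2 * n) * x$2 = - K * sin v"
    "x$3 ^ (2 * m - 1) = K * d"
    using GDERIV_unique[OF GDERIV_Phi[OF m] grad] m
    by (auto simp: vector_3_eq_iff r2 n K_def field_simps simp flip: power_mult)
  \<comment> \<open>Summing the squares of the two horizontal equations eliminates the angle and
    leaves r^(2m-1) = K.\<close>
  have "(r ^ (2 * m - 1))\<^sup>2 = (r ^ (2 * n))\<^sup>2 * ((x$1)\<^sup>2 + (x$2)\<^sup>2)"
    by (simp add: r2 n power_mult_distrib)
  also have "\<dots> = (r ^ (2 * n) * x$1)\<^sup>2 + (r ^ (2 * n) * x$2)\<^sup>2"
    by (simp add: algebra_simps power_mult_distrib)
  also have "\<dots> = K\<^sup>2 * ((cos v)\<^sup>2 + (sin v)\<^sup>2)"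
    unfolding eqs by (simp add: power_mult_distrib distrib_left
        del: sin_cos_squared_add sin_cos_squared_add2 sin_cos_squared_add3)
  finally have rK: "r ^ (2 * m - 1) = K"
    using K r by simp
  have "r \<noteq> 0"
    using rK K m by (auto simp: power_0_left n)
  then have r: "r > 0"
    using r by simp
  have x: "x$1 = - r * cos v" "x$2 = - r * sin v"
  proof -
    have "r ^ (2 * n) * x$1 = r ^ (2 * n) * (- r * cos v)"
      "r ^ (2 * n) * x$2 = r ^ (2 * n) * (- r * sin v)"
      using eqs by (simp_all add: n flip: rK)
    then show "x$1 = - r * cos v" "x$2 = - r * sin v"
      using r by (metis mult_left_cancel power_not_zero less_irrefl)+
  qed
  have "x$3 ^ (2 * m - 1) = r ^ (2 * m - 1) * d"
    by (simp only: rK eqs(3))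
  moreover have "r ^ (2 * m) + x$3 ^ (2 * m) = 1"
    using sphere by (simp add: Phi_def r2 flip: power_mult)
  ultimately have "r = profile_radius m d" "x$3 = profile_height m d"
    using profile_unique[OF m r] by blast+
  with x show ?thesis
    by (simp add: vec_eq_iff forall_3)
qed

lemma sphere_point:
  assumes "m > 0"
  shows "Phi m (vector [- profile_radius m d * cos v, - profile_radius m d * sin v,
    profile_height m d]) = 1"
proof -
  have "(profile_radius m d * cos v)\<^sup>2 + (profile_radius m d * sin v)\<^sup>2 = (profile_radius m d)\<^sup>2"
    by (simp add: power_mult_distrib flip: distrib_left)
  then show ?thesis
    using profile_sphere[OF assms, of d] by (simp add: Phi_def flip: power_mult)
qed

text \<open>The factor is the quotient of the horizontal lengths: 2m R^(2m-1) for the gradient and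
  \<open>a\<close> for the given vector. The vertical components then agree by
  \<open>profile_slope\<close>.\<close>

lemma sphere_point_GDERIV:
  assumes m: "m > 0" and a: "a > 0"
  shows "GDERIV (Phi m) (vector [- profile_radius m d * cos v, - profile_radius m d * sin v,
      profile_height m d]) :>
    (2 * real m * profile_radius m d ^ (2 * m - 1) / a) *\<^sub>R
      vector [- a * cos v, - a * sin v, a * d]"
proof -
  let ?r = "profile_radius m d"
  have power: "?r ^ (2 * m - 1) = (?r\<^sup>2) ^ (m - 1) * ?r"
    using m by (cases m) (simp_all add: power_mult)
  have r2: "(?r * cos v)\<^sup>2 + (?r * sin v)\<^sup>2 = ?r\<^sup>2"
    by (simp add: power_mult_distrib flip: distrib_left)
  show ?thesis
    by (rule GDERIV_subst[OF GDERIV_Phi[OF m]])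
      (use a in \<open>auto simp: vector_3_eq_iff r2 profile_slope[OF m] power
        simp del: One_nat_def\<close>)
qed

section \<open>Derivatives and tangent planes of rotational surfaces\<close>

lemma has_derivative_vector_3:
  fixes f g h :: "'a::real_normed_vector \<Rightarrow> real"
  assumes "(f has_derivative f') (at x)" "(g has_derivative g') (at x)"
    "(h has_derivative h') (at x)"
  shows "((\<lambda>x. vector [f x, g x, h x] :: real^3) has_derivative
    (\<lambda>x. vector [f' x, g' x, h' x])) (at x)"
proof -
  \<comment> \<open>Expanding in the standard basis reduces the claim to sums of scalar functions
    times fixed vectors.\<close>
  have eq: "(vector [p, q, r] :: real^3) = p *\<^sub>R axis 1 1 + q *\<^sub>R axis 2 1 + r *\<^sub>R axis 3 1" for p q r
    by (simp add: vec_eq_iff forall_3 axis_def)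
  show ?thesis
    unfolding eq
    by (intro has_derivative_add has_derivative_scaleR_left assms)
qed

lemma rot_surface_has_derivative:
  assumes "(\<alpha> has_real_derivative \<alpha>') (at s)" "(\<beta> has_real_derivative \<beta>') (at s)"
  shows "(rot_surface \<alpha> \<beta> has_derivative
    (\<lambda>(h, k). vector [\<alpha>' * cos v * h - \<alpha> s * sin v * k,
      \<alpha>' * sin v * h + \<alpha> s * cos v * k, \<beta>' * h])) (at (s, v))"
proof -
  \<comment> \<open>Every factor in the coordinates depends on one parameter only, so the chain rule
    with a projection suffices.\<close>
  have fst: "((\<lambda>p. f (fst p)) has_derivative (\<lambda>h. f' * fst h)) (at (s, v))"
    if "(f has_real_derivative f') (at s)" for f f'
    using has_derivative_compose[of fst fst "(s, v)" UNIV f "(*) f'"] that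
    by (simp add: has_field_derivative_def has_derivative_fst has_derivative_snd)
  have snd: "((\<lambda>p. f (snd p)) has_derivative (\<lambda>h. f' * snd h)) (at (s, v))"
    if "(f has_real_derivative f') (at v)" for f f'
    using has_derivative_compose[of snd snd "(s, v)" UNIV f "(*) f'"] that
    by (simp add: has_field_derivative_def has_derivative_fst has_derivative_snd)
  show ?thesis
    unfolding rot_surface_def case_prod_unfold
    by (rule has_derivative_subst[OF has_derivative_vector_3
          [OF has_derivative_mult[OF fst[OF assms(1)] snd[OF DERIV_cos]]
              has_derivative_mult[OF fst[OF assms(1)] snd[OF DERIV_sin]]
              fst[OF assms(2)]]])
      (rule ext, simp add: case_prod_unfold vector_3_eq_iff algebra_simps)
qed

lemma rot_surface_partials:
  assumes "(\<alpha> has_real_derivative \<alpha>') (at s)" "(\<beta> has_real_derivative \<beta>') (at s)"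
  shows "partial_u (rot_surface \<alpha> \<beta>) (s, v) = vector [\<alpha>' * cos v, \<alpha>' * sin v, \<beta>']"
    and "partial_v (rot_surface \<alpha> \<beta>) (s, v) = vector [- \<alpha> s * sin v, \<alpha> s * cos v, 0]"
  by (simp_all flip: frechet_derivative_at[OF rot_surface_has_derivative[OF assms]])

text \<open>For \<open>\<alpha> s > 0\<close> the horizontal part points towards the axis; this is
  the origin of the minus sign in the profile (- R, Z) of the Gauss map.\<close>

lemma rot_surface_cross3:
  assumes "(\<alpha> has_real_derivative \<alpha>') (at s)"
  shows "cross3 (partial_u (rot_surface \<alpha> (\<lambda>t. t)) (s, v))
      (partial_v (rot_surface \<alpha> (\<lambda>t. t)) (s, v)) =
    vector [- \<alpha> s * cos v, - \<alpha> s * sin v, \<alpha> s * \<alpha>']"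
proof -
  have "(\<alpha>' * cos v) * (\<alpha> s * cos v) - (\<alpha>' * sin v) * (- \<alpha> s * sin v) =
    \<alpha> s * \<alpha>' * ((sin v)\<^sup>2 + (cos v)\<^sup>2)"
    by algebra
  then show ?thesis
    unfolding rot_surface_partials[OF assms DERIV_ident] cross3_def vector_3 by simp
qed

text \<open>The vector on the right is the cross product of the partial derivatives. That the range
  is orthogonal to it is a computation; conversely, a preimage of an orthogonal vector is solved for
  explicitly.\<close>

lemma rot_surface_tangent_plane:
  assumes "(\<alpha> has_real_derivative \<alpha>') (at s)" and "\<alpha> s \<noteq> 0"
  shows "range (frechet_derivative (rot_surface \<alpha> (\<lambda>t. t)) (at (s, v))) =
    {w. inner w (vector [- \<alpha> s * cos v, - \<alpha> s * sin v, \<alpha> s * \<alpha>']) = 0}"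
    (is "range ?D = ?T")
proof -
  have D: "?D = (\<lambda>(h, k). vector [\<alpha>' * cos v * h - \<alpha> s * sin v * k,
      \<alpha>' * sin v * h + \<alpha> s * cos v * k, 1 * h])"
    by (rule frechet_derivative_at[symmetric])
      (rule rot_surface_has_derivative[OF assms(1) DERIV_ident])
  show ?thesis
  proof (intro equalityI subsetI)
    fix w assume "w \<in> range ?D"
    then obtain h k where "w = vector [\<alpha>' * cos v * h - \<alpha> s * sin v * k,
      \<alpha>' * sin v * h + \<alpha> s * cos v * k, 1 * h]"
      by (auto simp: D)
    then have "inner w (vector [- \<alpha> s * cos v, - \<alpha> s * sin v, \<alpha> s * \<alpha>']) =
      \<alpha> s * \<alpha>' * h * (1 - ((sin v)\<^sup>2 + (cos v)\<^sup>2))"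
      by (simp add: inner_vec_def sum_3 power2_eq_square algebra_simps
          del: sin_cos_squared_add sin_cos_squared_add2 sin_cos_squared_add3)
    then show "w \<in> ?T"
      by simp
  next
    fix w assume "w \<in> ?T"
    then have "\<alpha> s * (w$1 * cos v + w$2 * sin v - \<alpha>' * w$3) = 0"
      by (simp add: inner_vec_def sum_3 algebra_simps)
    then have w: "\<alpha>' * w$3 = w$1 * cos v + w$2 * sin v"
      using assms(2) by simp
    \<comment> \<open>The component of \<open>w\<close> along the rotation direction (- sin v, cos
      v, 0), divided by the length of X_v up to sign; the other parameter is read off from the third
      coordinate.\<close>
    define k where "k = (w$2 * cos v - w$1 * sin v) / \<alpha> s"
    have k: "\<alpha> s * k = w$2 * cos v - w$1 * sin v"
      using assms(2) by (simp add: k_def)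
    have "\<alpha>' * cos v * w$3 - \<alpha> s * sin v * k = (\<alpha>' * w$3) * cos v - (\<alpha> s * k) * sin v"
      by simp
    also have "\<dots> = w$1 * ((sin v)\<^sup>2 + (cos v)\<^sup>2)"
      unfolding w k by algebra
    finally have 1: "\<alpha>' * cos v * w$3 - \<alpha> s * sin v * k = w$1"
      by simp
    have "\<alpha>' * sin v * w$3 + \<alpha> s * cos v * k = (\<alpha>' * w$3) * sin v + (\<alpha> s * k) * cos v"
      by simp
    also have "\<dots> = w$2 * ((sin v)\<^sup>2 + (cos v)\<^sup>2)"
      unfolding w k by algebra
    finally have 2: "\<alpha>' * sin v * w$3 + \<alpha> s * cos v * k = w$2"
      by simp
    have "?D (w$3, k) = w"
      using 1 2 by (simp add: D vector_3_eq_iff)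
    then show "w \<in> range ?D"
      by (metis rangeI)
  qed
qed

section \<open>The surface over its height and its Birkhoff-Gauss map\<close>

locale height_surface =
  fixes m :: nat and I :: "real set" and u :: "real \<Rightarrow> real"
  assumes m: "m > 0"
    and open_I: "open I" and interval_I: "is_interval I" and pos_I: "\<And>a. a \<in> I \<Longrightarrow> a > 0"
    and u_differentiable: "\<And>a. a \<in> I \<Longrightarrow> u differentiable (at a)"
    and deriv_u_differentiable: "\<And>a. a \<in> I \<Longrightarrow> deriv u differentiable (at a)"
    and deriv_u_nonzero: "\<And>a. a \<in> I \<Longrightarrow> deriv u a \<noteq> 0"
begin

text \<open>The profile is a function of the distance \<open>a\<close> from the axis instead of the
  height, so that the curvature condition becomes an equation in \<open>a\<close>. By the inverse
  function rule, \<open>1 / deriv u a\<close> is the slope at height \<open>u a\<close>.\<close>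

definition radius :: "real \<Rightarrow> real" where
  "radius = (\<lambda>a. profile_radius m (1 / deriv u a))"

definition height :: "real \<Rightarrow> real" where
  "height = (\<lambda>a. profile_height m (1 / deriv u a))"

abbreviation A :: "real \<Rightarrow> real" where
  "A \<equiv> the_inv_into I u"

definition normal :: "real \<times> real \<Rightarrow> real^3" where
  "normal = rot_surface (\<lambda>t. - radius (A t)) (\<lambda>t. height (A t))"

lemma DERIV_u: "a \<in> I \<Longrightarrow> (u has_real_derivative deriv u a) (at a)"
  using u_differentiable by (simp add: DERIV_deriv_iff_real_differentiable)

lemma DERIV_u_iff: "a \<in> I \<Longrightarrow> (u has_real_derivative D) (at a) \<longleftrightarrow> deriv u a = D"
  using DERIV_u DERIV_imp_deriv by blast

lemma continuous_u: "continuous_on I u"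
  by (meson DERIV_u DERIV_isCont continuous_at_imp_continuous_on)

text \<open>By Rolle's theorem, two equal values would force a zero of the derivative between
  them.\<close>

lemma inj_u: "inj_on u I"
proof (rule linorder_inj_onI)
  fix a b assume ab: "a < b" "a \<in> I" "b \<in> I"
  then have sub: "{a..b} \<subseteq> I"
    using interval_I by (meson atLeastAtMost_iff mem_is_interval_1_I subsetI)
  show "u a \<noteq> u b"
  proof
    assume "u a = u b"
    have "(u has_derivative (*) (deriv u x)) (at x)" if "a < x" "x < b" for x
    proof -
      have "x \<in> I"
        using that by (intro subsetD[OF sub]) simp
      then show ?thesis
        using DERIV_u by (simp add: has_field_derivative_def)
    qed
    from Rolle_deriv[OF ab(1) \<open>u a = u b\<close> continuous_on_subset[OF continuous_u sub] this]
    obtain z where z: "a < z" "z < b" "(*) (deriv u z) = (\<lambda>v. 0)"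
      by auto
    from fun_cong[OF z(3), of 1] have "deriv u z = 0"
      by simp
    moreover have "z \<in> I"
      using z(1,2) by (intro subsetD[OF sub]) simp
    ultimately show False
      using deriv_u_nonzero by blast
  qed
qed auto

lemma A_u: "a \<in> I \<Longrightarrow> A (u a) = a"
  by (rule the_inv_into_f_f[OF inj_u])

text \<open>A continuous injection on an interval is an open map. Openness allows derivatives to be
  transferred between maps that agree on the domain.\<close>

lemma open_domain: "open (height_domain I u)"
proof -
  have "open (u ` I)"
    using injective_eq_1d_open_map_UNIV[OF continuous_u interval_I] inj_u open_I by blast
  moreover have "height_domain I u = u ` I \<times> UNIV"
    by (auto simp: height_domain_def)
  ultimately show ?thesis
    by (simp add: open_Times)
qed

lemma DERIV_A:
  assumes "a \<in> I"
  shows "(A has_real_derivative 1 / deriv u a) (at (u a))"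
  unfolding has_field_derivative_def
proof (rule has_derivative_inverse_strong[OF open_I assms continuous_u A_u])
  show "(u has_derivative (*) (deriv u a)) (at a)"
    using DERIV_u[OF assms] by (simp add: has_field_derivative_def)
  show "(*) (deriv u a) \<circ> (*) (1 / deriv u a) = id"
    using deriv_u_nonzero[OF assms] by (simp add: fun_eq_iff)
qed

lemma slope_differentiable: "a \<in> I \<Longrightarrow> (\<lambda>a. 1 / deriv u a) differentiable (at a)"
  by (intro differentiable_divide deriv_u_differentiable deriv_u_nonzero) auto

lemma DERIV_radius:
  assumes "a \<in> I"
  shows "(radius has_real_derivative deriv radius a) (at a)"
  unfolding DERIV_deriv_iff_real_differentiable radius_def
  by (rule differentiable_compose[OF profile_radius_differentiable slope_differentiable])
    (use assms deriv_u_nonzero m in auto)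

text \<open>Differentiate R^(2m) + Z^(2m) = 1 and insert the slope relation; the common factor
  R^(2m-1) cancels. The resulting relation between Z' and R' is what makes eta_u a multiple of
  X_u.\<close>

lemma DERIV_height:
  assumes "a \<in> I"
  shows "(height has_real_derivative - deriv u a * deriv radius a) (at a)"
proof -
  have "height differentiable (at a)"
    unfolding height_def
    by (rule differentiable_compose[OF profile_height_differentiable slope_differentiable])
      (use assms deriv_u_nonzero m in auto)
  then have h: "(height has_real_derivative deriv height a) (at a)"
    by (simp add: DERIV_deriv_iff_real_differentiable)
  have "radius a > 0"
    by (simp add: radius_def profile_radius_pos m)
  have slope: "height a ^ (2 * m - 1) = radius a ^ (2 * m - 1) * (1 / deriv u a)"
    unfolding height_def radius_def by (rule profile_slope[OF m])
  have DERIV: "((\<lambda>a. radius a ^ (2 * m) + height a ^ (2 * m)) has_real_derivative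
      2 * m * radius a ^ (2 * m - 1) * deriv radius a +
      2 * m * height a ^ (2 * m - 1) * deriv height a) (at a)"
    by (rule derivative_eq_intros DERIV_radius[OF assms] h refl | simp)+
  have const: "(\<lambda>a. radius a ^ (2 * m) + height a ^ (2 * m)) = (\<lambda>_. 1)"
    by (simp add: radius_def height_def profile_sphere m)
  have "2 * m * radius a ^ (2 * m - 1) * deriv radius a +
      2 * m * height a ^ (2 * m - 1) * deriv height a = 0"
    using DERIV[unfolded const] DERIV_const by (rule DERIV_unique)
  then have "2 * m * radius a ^ (2 * m - 1) * (deriv radius a + deriv height a / deriv u a) = 0"
    unfolding slope by (simp add: algebra_simps)
  then have "deriv radius a + deriv height a / deriv u a = 0"
    using \<open>radius a > 0\<close> m by simp
  then have "deriv height a / deriv u a = - deriv radius a"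
    by simp
  then have "deriv height a = - deriv u a * deriv radius a"
    using deriv_u_nonzero[OF assms] by (simp add: divide_eq_eq)
  with h show ?thesis
    by simp
qed

lemma height_param_partials:
  assumes "a \<in> I"
  shows "partial_u (height_param I u) (u a, v) = vector [cos v / deriv u a, sin v / deriv u a, 1]"
    and "partial_v (height_param I u) (u a, v) = vector [- a * sin v, a * cos v, 0]"
  unfolding height_param_def
  using rot_surface_partials[OF DERIV_A[OF assms] DERIV_ident] A_u[OF assms] by simp_all

lemma height_param_cross3:
  assumes "a \<in> I"
  shows "cross3 (partial_u (height_param I u) (u a, v)) (partial_v (height_param I u) (u a, v)) =
    vector [- a * cos v, - a * sin v, a * (1 / deriv u a)]"
  using rot_surface_cross3[OF DERIV_A[OF assms], of v]
  unfolding height_param_def A_u[OF assms] .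

lemma normal_apply:
  assumes "a \<in> I"
  shows "normal (u a, v) = vector [- profile_radius m (1 / deriv u a) * cos v,
    - profile_radius m (1 / deriv u a) * sin v, profile_height m (1 / deriv u a)]"
  by (simp add: normal_def rot_surface_def A_u[OF assms] radius_def height_def)

lemma DERIV_radius_A:
  assumes "a \<in> I"
  shows "((\<lambda>t. - radius (A t)) has_real_derivative - (deriv radius a / deriv u a)) (at (u a))"
  using DERIV_minus[OF DERIV_chain2[OF _ DERIV_A[OF assms], of radius "deriv radius a"]]
    DERIV_radius[OF assms] A_u[OF assms] by simp

lemma DERIV_height_A:
  assumes "a \<in> I"
  shows "((\<lambda>t. height (A t)) has_real_derivative - deriv radius a) (at (u a))"
  using DERIV_chain2[OF _ DERIV_A[OF assms], of height "- deriv u a * deriv radius a"]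
    DERIV_height[OF assms] A_u[OF assms] deriv_u_nonzero[OF assms] by simp

lemma normal_partials:
  assumes "a \<in> I"
  shows "partial_u normal (u a, v) = vector [- (deriv radius a / deriv u a) * cos v,
      - (deriv radius a / deriv u a) * sin v, - deriv radius a]"
    and "partial_v normal (u a, v) = vector [radius a * sin v, - radius a * cos v, 0]"
  unfolding normal_def
  using rot_surface_partials[OF DERIV_radius_A[OF assms] DERIV_height_A[OF assms]] A_u[OF assms]
  by simp_all

lemma normal_differentiable: "a \<in> I \<Longrightarrow> normal differentiable (at (u a, v))"
  unfolding normal_def
  using rot_surface_has_derivative[OF DERIV_radius_A DERIV_height_A] differentiableI by blast

lemma GDERIV_normal:
  assumes "a \<in> I"
  shows "GDERIV (Phi m) (normal (u a, v)) :>
    (2 * real m * radius a ^ (2 * m - 1) / a) *\<^sub>R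
      cross3 (partial_u (height_param I u) (u a, v)) (partial_v (height_param I u) (u a, v))"
  unfolding height_param_cross3[OF assms] normal_apply[OF assms] radius_def
  by (rule sphere_point_GDERIV[OF m pos_I[OF assms]])

lemma normal_scale_pos:
  assumes "a \<in> I"
  shows "2 * real m * radius a ^ (2 * m - 1) / a > 0"
  using pos_I[OF assms] m by (simp add: radius_def profile_radius_pos)

lemma normal_positively_oriented:
  "positively_oriented m (height_param I u) (height_domain I u) normal"
  unfolding positively_oriented_def height_domain_def
  using GDERIV_normal normal_scale_pos by blast

lemma normal_birkhoff:
  "birkhoff_gauss_map m (height_param I u) (height_domain I u) normal"
  unfolding birkhoff_gauss_map_def
proof
  fix p assume "p \<in> height_domain I u"
  then obtain a v where a: "a \<in> I" and p: "p = (u a, v)"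
    by (auto simp: height_domain_def)
  define s where "s = 2 * real m * radius a ^ (2 * m - 1) / a"
  have "s > 0"
    using normal_scale_pos[OF a] by (simp only: s_def)
  \<comment> \<open>The gradient is \<open>s\<close> times the surface normal, and a positive factor
    does not change the orthogonal plane.\<close>
  have "frechet_derivative (Phi m) (at (normal p)) w =
      s * inner w (vector [- a * cos v, - a * sin v, a * (1 / deriv u a)])" for w
    using GDERIV_normal[OF a, of v] unfolding gderiv_def p height_param_cross3[OF a] s_def[symmetric]
    by (simp flip: frechet_derivative_at)
  then have "sphere_tangent_plane m (normal p) =
      {w. inner w (vector [- a * cos v, - a * sin v, a * (1 / deriv u a)]) = 0}"
    unfolding sphere_tangent_plane_def using \<open>s > 0\<close> by simp
  also have "\<dots> = range (frechet_derivative (height_param I u) (at p))"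
    using rot_surface_tangent_plane[OF DERIV_A[OF a], of v] pos_I[OF a]
    unfolding p height_param_def A_u[OF a] by simp
  finally show "normal p \<in> unit_sphere m \<and> normal differentiable (at p) \<and>
      sphere_tangent_plane m (normal p) = range (frechet_derivative (height_param I u) (at p))"
    using normal_differentiable[OF a] sphere_point[OF m]
    by (simp add: unit_sphere_eq m p normal_apply[OF a])
qed

text \<open>Lying on the sphere and having a gradient positively proportional to the surface normal
  leaves only one point, by \<open>sphere_point_unique\<close>.\<close>

lemma gauss_map_unique:
  assumes "birkhoff_gauss_map m (height_param I u) (height_domain I u) \<eta>"
    and "positively_oriented m (height_param I u) (height_domain I u) \<eta>"
    and "p \<in> height_domain I u"
  shows "\<eta> p = normal p"
proof -
  obtain a v where a: "a \<in> I" and p: "p = (u a, v)"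
    using assms(3) by (auto simp: height_domain_def)
  have "Phi m (\<eta> p) = 1"
    using assms(1,3) m by (auto simp: birkhoff_gauss_map_def unit_sphere_eq)
  moreover obtain \<phi> where "\<phi> > 0" "GDERIV (Phi m) (\<eta> p) :> \<phi> *\<^sub>R
      vector [- a * cos v, - a * sin v, a * (1 / deriv u a)]"
    using assms(2,3) height_param_cross3[OF a] unfolding positively_oriented_def p by metis
  ultimately show ?thesis
    using sphere_point_unique[OF m _ pos_I[OF a]] normal_apply[OF a] p by simp
qed

section \<open>The curvature relation as a differential equation\<close>

text \<open>Comparing the partial derivatives of \<open>normal\<close> with those of the surface
  gives k1 = - R' and k2 = - R / a; multiplying the relation by - a clears the denominator.\<close>

lemma curvature_relation_iff:
  "satisfies_curvature_relation m c I u \<longleftrightarrow> (\<forall>a\<in>I. deriv radius a * a + c * radius a = 0)"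
proof
  assume "satisfies_curvature_relation m c I u"
  then obtain \<eta> k1 k2 where
    \<eta>: "birkhoff_gauss_map m (height_param I u) (height_domain I u) \<eta>"
      "positively_oriented m (height_param I u) (height_domain I u) \<eta>"
    and k: "rot_principal_curvatures (height_param I u) (height_domain I u) \<eta> k1 k2"
      "\<And>p. p \<in> height_domain I u \<Longrightarrow> k1 p + c * k2 p = 0"
    unfolding satisfies_curvature_relation_def by blast
  show "\<forall>a\<in>I. deriv radius a * a + c * radius a = 0"
  proof
    fix a assume a: "a \<in> I"
    \<comment> \<open>By rotational symmetry one meridian suffices; at v = 0 the second component of
      the v-derivatives is nonzero.\<close>
    let ?p = "(u a, 0)"
    have p: "?p \<in> height_domain I u"
      using a by (auto simp: height_domain_def)
    \<comment> \<open>Pointwise uniqueness holds on an open set, so it carries over to the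
      derivatives.\<close>
    have "(\<eta> has_derivative frechet_derivative normal (at ?p)) (at ?p)"
      using has_derivative_transform_within_open[OF _ open_domain p]
        normal_differentiable[OF a] gauss_map_unique[OF \<eta>] by (metis frechet_derivative_works)
    then have "frechet_derivative \<eta> (at ?p) = frechet_derivative normal (at ?p)"
      by (rule frechet_derivative_at[symmetric])
    with k(1) p have "partial_u normal ?p = k1 ?p *\<^sub>R partial_u (height_param I u) ?p"
      "partial_v normal ?p = k2 ?p *\<^sub>R partial_v (height_param I u) ?p"
      by (auto simp: rot_principal_curvatures_def)
    then have "- deriv radius a = k1 ?p" "- radius a = k2 ?p * a"
      unfolding normal_partials[OF a] height_param_partials[OF a]
      by (auto simp: vector_3_eq_iff)
    then have "deriv radius a = - k1 ?p" "radius a = - (k2 ?p * a)"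
      by simp_all
    then have "deriv radius a * a + c * radius a = - ((k1 ?p + c * k2 ?p) * a)"
      by (simp add: algebra_simps)
    then show "deriv radius a * a + c * radius a = 0"
      using k(2)[OF p] by simp
  qed
next
  assume R: "\<forall>a\<in>I. deriv radius a * a + c * radius a = 0"
  let ?k1 = "\<lambda>p. - deriv radius (A (fst p))" and ?k2 = "\<lambda>p. - radius (A (fst p)) / A (fst p)"
  have "rot_principal_curvatures (height_param I u) (height_domain I u) normal ?k1 ?k2"
    unfolding rot_principal_curvatures_def
  proof
    fix p assume "p \<in> height_domain I u"
    then obtain a v where a: "a \<in> I" and p: "p = (u a, v)"
      by (auto simp: height_domain_def)
    show "partial_u normal p = ?k1 p *\<^sub>R partial_u (height_param I u) p \<and>
        partial_v normal p = ?k2 p *\<^sub>R partial_v (height_param I u) p"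
      unfolding p normal_partials[OF a] height_param_partials[OF a] fst_conv A_u[OF a]
      using pos_I[OF a] by (simp add: vector_3_eq_iff)
  qed
  moreover have "?k1 p + c * ?k2 p = 0" if domain: "p \<in> height_domain I u" for p
  proof -
    obtain a v where a: "a \<in> I" and p: "p = (u a, v)"
      using domain by (auto simp: height_domain_def)
    have "?k1 p + c * ?k2 p = - (deriv radius a * a + c * radius a) / a"
      using pos_I[OF a] by (simp add: p A_u[OF a] field_simps)
    then show ?thesis
      using R a by simp
  qed
  ultimately show "satisfies_curvature_relation m c I u"
    unfolding satisfies_curvature_relation_def
    using normal_birkhoff normal_positively_oriented by blast
qed

text \<open>The integrating factor is a^(c-1): it turns the left side of the equation into the
  derivative of R a^c, which is therefore constant on the interval.\<close>

lemma radius_ode_iff: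
  assumes "I \<noteq> {}"
  shows "(\<forall>a\<in>I. deriv radius a * a + c * radius a = 0) \<longleftrightarrow>
    (\<exists>K>0. \<forall>a\<in>I. radius a = K * a powr (- c))"
proof
  have DERIV: "((\<lambda>a. radius a * a powr c) has_real_derivative
      (deriv radius a * a + c * radius a) * a powr (c - 1)) (at a)" if "a \<in> I" for a
  proof -
    have powr: "((\<lambda>a. a powr c) has_real_derivative c * a powr (c - 1)) (at a)"
      by (rule has_real_derivative_powr[OF pos_I[OF that]])
    have "a powr c = a powr (c - 1) * a"
      using pos_I[OF that] by (simp add: powr_diff)
    then have "deriv radius a * a powr c + c * a powr (c - 1) * radius a =
        (deriv radius a * a + c * radius a) * a powr (c - 1)"
      by (simp add: algebra_simps)
    with DERIV_mult[OF DERIV_radius[OF that] powr] show ?thesis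
      by simp
  qed
  assume "\<forall>a\<in>I. deriv radius a * a + c * radius a = 0"
  then have "((\<lambda>a. radius a * a powr c) has_real_derivative 0) (at a within I)" if "a \<in> I" for a
    using has_field_derivative_at_within[OF DERIV[OF that]] that by simp
  from has_field_derivative_zero_constant[OF is_interval_convex[OF interval_I] this]
  obtain K where K: "\<And>a. a \<in> I \<Longrightarrow> radius a * a powr c = K"
    by auto
  \<comment> \<open>A point of \<open>I\<close> transfers the positivity of the radius to the
    constant \<open>K\<close>.\<close>
  obtain a where a: "a \<in> I"
    using assms by blast
  then have "K > 0"
    using pos_I[OF a] by (simp add: radius_def profile_radius_pos m flip: K[OF a])
  moreover have "radius a = K * a powr (- c)" if "a \<in> I" for a
    using pos_I[OF that] by (simp add: powr_minus field_simps flip: K[OF that])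
  ultimately show "\<exists>K>0. \<forall>a\<in>I. radius a = K * a powr (- c)"
    by blast
next
  assume "\<exists>K>0. \<forall>a\<in>I. radius a = K * a powr (- c)"
  then obtain K where K: "\<And>a. a \<in> I \<Longrightarrow> radius a = K * a powr (- c)"
    by blast
  show "\<forall>a\<in>I. deriv radius a * a + c * radius a = 0"
  proof
    fix a assume a: "a \<in> I"
    have "((\<lambda>a. K * a powr (- c)) has_real_derivative K * (- c * a powr (- c - 1))) (at a)"
      by (rule DERIV_cmult has_real_derivative_powr pos_I[OF a])+
    then have "(radius has_real_derivative K * (- c * a powr (- c - 1))) (at a)"
      by (rule has_field_derivative_transform_within_open[OF _ open_I a]) (simp add: K)
    then have "deriv radius a = K * (- c * a powr (- c - 1))"
      by (rule DERIV_imp_deriv)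
    then show "deriv radius a * a + c * radius a = 0"
      using pos_I[OF a] by (simp add: K[OF a] powr_diff)
  qed
qed

text \<open>\<open>deriv u\<close> is differentiable, hence continuous, so a change of sign would
  produce a zero by the intermediate value theorem.\<close>

lemma deriv_u_sign: "(\<forall>a\<in>I. deriv u a > 0) \<or> (\<forall>a\<in>I. deriv u a < 0)"
proof (rule ccontr)
  assume "\<not> ?thesis"
  then obtain a b where ab: "a \<in> I" "b \<in> I" "deriv u a < 0" "deriv u b > 0"
    using deriv_u_nonzero by (metis linorder_neqE_linordered_idom)
  have "continuous_on I (deriv u)"
    using deriv_u_differentiable
    by (meson continuous_at_imp_continuous_on differentiable_imp_continuous_within)
  then have "connected (deriv u ` I)"
    using interval_I is_interval_connected_1 connected_continuous_image by blast
  then have "0 \<in> deriv u ` I"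
    using connectedD_interval[of "deriv u ` I" "deriv u a" "deriv u b" 0] ab by auto
  then show False
    using deriv_u_nonzero by auto
qed

end

section \<open>From the radius to the integrand\<close>

text \<open>Both sides of the radius equation are positive, so it may be raised to the power 2m; it
  then becomes rational in B = R^(-2m) - 1 and can be solved for
  \<open>\<bar>g\<bar>\<close>.\<close>

lemma profile_radius_eq_iff:
  assumes m: "m > 0" and g: "g \<noteq> 0" and a: "a > 0" and c: "c > 0"
  shows "profile_radius m (1 / g) = c powr l * a powr (- l) \<longleftrightarrow>
    a powr (2 * real m * l) > c powr (2 * real m * l) \<and>
    \<bar>g\<bar> = c powr ((2 * real m - 1) * l) /
      (a powr (2 * real m * l) - c powr (2 * real m * l)) powr ((2 * real m - 1) / (2 * real m))"
proof -
  define x where "x = a powr (2 * real m * l)"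
  define y where "y = c powr (2 * real m * l)"
  define e where "e = (2 * real m - 1) / (2 * real m)"
  define b where "b = root (2 * m - 1) (1 / g)"
  define B where "B = b ^ (2 * m)"
  have x: "x > 0" and y: "y > 0" and e: "e > 0"
    using a c m by (auto simp: x_def y_def e_def)
  have odd: "odd (2 * m - 1)"
    using m by simp
  have b: "b ^ (2 * m - 1) = 1 / g"
    unfolding b_def by (rule odd_real_root_pow[OF odd])
  have "b \<noteq> 0"
    using b g m by (auto simp: power_0_left)
  then have B: "B > 0"
    by (simp add: B_def zero_less_power_eq)
  \<comment> \<open>Since \<open>\<bar>b\<bar> ^ (2 * m - 1)\<close> is
    \<open>1 / \<bar>g\<bar>\<close>, the exponent \<open>e\<close> is the one that recovers
    \<open>\<bar>g\<bar>\<close> from \<open>B\<close>.\<close>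
  have "B powr e = \<bar>b\<bar> powr (2 * real m - 1)"
    using \<open>b \<noteq> 0\<close> m
    by (simp add: B_def e_def powr_powr flip: power_even_abs[of "2 * m" b] powr_realpow)
  also have "\<dots> = \<bar>b\<bar> ^ (2 * m - 1)"
    using \<open>b \<noteq> 0\<close> m by (simp add: of_nat_diff flip: powr_realpow)
  also have "\<dots> = 1 / \<bar>g\<bar>"
    by (simp add: b power_abs[symmetric] del: One_nat_def)
  finally have Bg: "\<bar>g\<bar> = 1 / B powr e"
    by simp
  have pow: "(c powr l * a powr (- l)) ^ (2 * m) = y / x"
    using a c by (simp add: x_def y_def power_mult_distrib powr_minus power_inverse
        divide_inverse ac_simps flip: powr_realpow add: powr_powr)
  have "profile_radius m (1 / g) = c powr l * a powr (- l) \<longleftrightarrow>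
      profile_radius m (1 / g) ^ (2 * m) = (c powr l * a powr (- l)) ^ (2 * m)"
    using m a c profile_radius_pos[OF m, of "1 / g"] by (simp add: power_eq_iff_eq_base)
  also have "\<dots> \<longleftrightarrow> 1 / (1 + B) = y / x"
    by (simp only: pow profile_radius_power[OF m] B_def b_def)
  \<comment> \<open>The equation says B = x / y - 1, so \<open>B > 0\<close> produces the strict
    inequality under which the integrand is defined.\<close>
  also have "\<dots> \<longleftrightarrow> y < x \<and> B = (x - y) / y"
    using B x y by (auto simp: field_simps)
  also have "\<dots> \<longleftrightarrow> y < x \<and> B powr e = ((x - y) / y) powr e"
  proof (rule conj_cong[OF refl])
    assume "y < x"
    then have "((x - y) / y) > 0"
      using y by simp
    \<comment> \<open>A positive exponent makes \<open>powr\<close> strictly increasing, hence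
      injective, on the positive reals.\<close>
    then show "B = (x - y) / y \<longleftrightarrow> B powr e = ((x - y) / y) powr e"
      using B e by (metis less_irrefl linorder_neqE_linordered_idom powr_less_mono2 less_imp_le)
  qed
  also have "\<dots> \<longleftrightarrow> y < x \<and> \<bar>g\<bar> = y powr e / (x - y) powr e"
    using B x y by (auto simp: Bg powr_divide field_simps)
  also have "y powr e = c powr ((2 * real m - 1) * l)"
    using c m by (simp add: y_def e_def powr_powr mult.commute)
  finally show ?thesis
    by (simp only: x_def y_def e_def)
qed

section \<open>Assembly of the equivalence\<close>

theorem theorem5p1:
  fixes m :: nat and lam :: real and I :: "real set" and u :: "real \<Rightarrow> real"
  assumes "m \<ge> 2"
    and "lam \<noteq> 0"
    and "open I" and "is_interval I" and "I \<noteq> {}" and "I \<subseteq> {0<..}"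
    and "smooth_on u I"
    and "\<forall>a\<in>I. deriv u a \<noteq> 0"
  shows "satisfies_curvature_relation m lam I u \<longleftrightarrow>
    (\<exists>c2>0. (\<forall>a\<in>I. a powr (2 * real m * lam) > c2 powr (2 * real m * lam)) \<and>
      (\<exists>\<sigma>\<in>{1, -1}. \<forall>a\<in>I.
        (u has_real_derivative
          \<sigma> * (c2 powr ((2 * real m - 1) * lam) /
            (a powr (2 * real m * lam) - c2 powr (2 * real m * lam))
              powr ((2 * real m - 1) / (2 * real m)))) (at a)))"
proof -
  have diff: "(deriv ^^ n) u differentiable (at a)" if "a \<in> I" for n a
    using assms(7) that unfolding smooth_on_def by blast
  \<comment> \<open>Smoothness is taken at orders 0 and 1: differentiability of \<open>u\<close> and
    of \<open>deriv u\<close>.\<close>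
  interpret height_surface m I u
    using assms diff[of _ 0] diff[of _ 1] by unfold_locales auto
  define G where "G c a = c powr ((2 * real m - 1) * lam) /
    (a powr (2 * real m * lam) - c powr (2 * real m * lam)) powr ((2 * real m - 1) / (2 * real m))"
    for c a
  define T where "T c \<longleftrightarrow> (\<forall>a\<in>I. a powr (2 * real m * lam) > c powr (2 * real m * lam))" for c
  have G_pos: "G c a > 0" if "c > 0" "T c" "a \<in> I" for c a
    using that by (auto simp: G_def T_def)
  have "satisfies_curvature_relation m lam I u \<longleftrightarrow>
      (\<exists>K>0. \<forall>a\<in>I. radius a = K * a powr (- lam))"
    by (simp only: curvature_relation_iff radius_ode_iff[OF assms(5)])
  also have "\<dots> \<longleftrightarrow> (\<exists>c>0. \<forall>a\<in>I. radius a = c powr lam * a powr (- lam))"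
  proof
    assume "\<exists>K>0. \<forall>a\<in>I. radius a = K * a powr (- lam)"
    then obtain K where K: "K > 0" "\<forall>a\<in>I. radius a = K * a powr (- lam)"
      by blast
    \<comment> \<open>As \<open>lam\<close> is nonzero, every positive constant is a power c^lam
      with c = K^(1/lam); this is c2.\<close>
    then have "(K powr (1 / lam)) powr lam = K"
      using assms(2) by (simp add: powr_powr)
    with K show "\<exists>c>0. \<forall>a\<in>I. radius a = c powr lam * a powr (- lam)"
      by (intro exI[of _ "K powr (1 / lam)"]) auto
  next
    assume "\<exists>c>0. \<forall>a\<in>I. radius a = c powr lam * a powr (- lam)"
    then show "\<exists>K>0. \<forall>a\<in>I. radius a = K * a powr (- lam)"
      by (metis powr_gt_zero less_irrefl)
  qed
  also have "\<dots> \<longleftrightarrow> (\<exists>c>0. T c \<and> (\<forall>a\<in>I. \<bar>deriv u a\<bar> = G c a))"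
    using profile_radius_eq_iff[OF m deriv_u_nonzero pos_I]
    unfolding radius_def T_def G_def by (intro ex_cong1 conj_cong refl) blast
  also have "\<dots> \<longleftrightarrow> (\<exists>c>0. T c \<and> (\<exists>\<sigma>\<in>{1, -1}. \<forall>a\<in>I. deriv u a = \<sigma> * G c a))"
  proof (intro ex_cong1 conj_cong refl)
    fix c assume c: "c > 0" "T c"
    show "(\<forall>a\<in>I. \<bar>deriv u a\<bar> = G c a) \<longleftrightarrow> (\<exists>\<sigma>\<in>{1, -1}. \<forall>a\<in>I. deriv u a = \<sigma> * G c a)"
      \<comment> \<open>The sign of \<open>deriv u\<close> on \<open>I\<close> supplies
        \<open>\<sigma>\<close>; conversely, \<open>G c a > 0\<close> turns
        \<open>\<bar>\<sigma> * G c a\<bar>\<close> into \<open>G c a\<close>.\<close>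
      using deriv_u_sign G_pos[OF c] by force
  qed
  also have "\<dots> \<longleftrightarrow> (\<exists>c>0. T c \<and>
      (\<exists>\<sigma>\<in>{1, -1}. \<forall>a\<in>I. (u has_real_derivative \<sigma> * G c a) (at a)))"
    by (simp add: DERIV_u_iff cong: ball_cong)
  finally show ?thesis
    unfolding T_def G_def .
qed

end
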